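(* Let $X$ be an $\mathbb{N}$-valued random variable with $T=\mathbb{E}X>0$ and density $f$ with respect to $\pi_T$. Let $(X_i)_{i\ge1}$ be i.i.d. copies of $X$. If $f$ is bounded away from zero and infinity, then $$\limsup_{n\to\infty}\left[n^2\,H\Big(\sum_{i=1}^nT_{1/n}(X_i)\,\Big|\,\pi_T\Big)\right]\le\Big(\frac{\operatorname{Var}(X)}{T}-1\Big)^2 .$$
   Context: $\mathbb{N}=\{0,1,2,\dots\}$. For $T>0$, $\pi_T(k)=e^{-T}T^k/k!$ is the Poisson measure on $\mathbb{N}$. "$X$ has density $f$ with respect to $\pi_T$" means $\mathbb{P}(X=k)=f(k)\pi_T(k)$ for all $k$. "Bounded away from zero and infinity" means there are constants $0<c\le C<\infty$ with $c\le f(k)\le C$ for all $k$. For $a\in[0,1]$ the $a$-thinning of $X$ is $T_a(X):=\sum_{i=1}^X B_i$, where $(B_i)_{i\ge1}$ are i.i.d. Bernoulli random variables with $\mathbb{P}(B_i=1)=a$, independent of $X$; the thinnings $T_{1/n}(X_1),\dots,T_{1/n}(X_n)$ are taken independent. If $Y$ has density $g$ with respect to $\pi_T$, the relative entropy is $H(Y|\pi_T)=\sum_k g(k)\log(g(k))\,\pi_T(k)$, with $0\log0=0$. *)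

theory Defs
  imports "HOL-Probability.Probability"
begin

definition has_poisson_density ::
  "'a measure \<Rightarrow> ('a \<Rightarrow> nat) \<Rightarrow> real \<Rightarrow> (nat \<Rightarrow> real) \<Rightarrow> bool" where
  "has_poisson_density M X T f \<longleftrightarrow>
     X \<in> M \<rightarrow>\<^sub>M count_space UNIV \<and>
     (\<forall>k. measure M {\<omega> \<in> space M. X \<omega> = k} = f k * pmf (poisson_pmf T) k)"

definition bounded_away :: "(nat \<Rightarrow> real) \<Rightarrow> bool" where
  "bounded_away f \<longleftrightarrow> (\<exists>c C. 0 < c \<and> c \<le> C \<and> (\<forall>k. c \<le> f k \<and> f k \<le> C))"

text \<open>
  \<open>is_thinning M a X Y\<close>: the random variable \<open>Y\<close> is a version of the thinning \<open>T\<^sub>a(X)\<close>.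
  Mutual independence of the family \<open>X, B 1, B 2, \<dots>\<close> says both that the \<open>B i\<close> are independent
  and that the whole sequence is independent of \<open>X\<close>; the index \<open>0\<close> is used for \<open>X\<close>.
\<close>
definition is_thinning ::
  "'a measure \<Rightarrow> real \<Rightarrow> ('a \<Rightarrow> nat) \<Rightarrow> ('a \<Rightarrow> nat) \<Rightarrow> bool" where
  "is_thinning M a X Y \<longleftrightarrow>
     (\<exists>B :: nat \<Rightarrow> 'a \<Rightarrow> nat.
        prob_space.indep_vars M (\<lambda>_. count_space UNIV) (\<lambda>i. if i = 0 then X else B i) UNIV \<and>
        (\<forall>i\<ge>1. measure M {\<omega> \<in> space M. B i \<omega> = 1} = a \<and>
               measure M {\<omega> \<in> space M. B i \<omega> = 0} = 1 - a) \<and>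
        (\<forall>\<omega>\<in>space M. Y \<omega> = (\<Sum>i=1..X \<omega>. B i \<omega>)))"

text \<open>
  For \<open>T > 0\<close> every point has positive Poisson mass, so the density of \<open>Y\<close> exists and is the
  quotient below.
\<close>
definition poisson_density :: "'a measure \<Rightarrow> ('a \<Rightarrow> nat) \<Rightarrow> real \<Rightarrow> nat \<Rightarrow> real" where
  "poisson_density M Y T k = measure M {\<omega> \<in> space M. Y \<omega> = k} / pmf (poisson_pmf T) k"

text \<open>
  The negative part of \<open>g log g\<close> is bounded, so the series either converges absolutely or
  diverges to \<open>\<infinity>\<close>. The convention \<open>0 log 0 = 0\<close> is automatic.
\<close>
definition poisson_rel_entropy :: "'a measure \<Rightarrow> ('a \<Rightarrow> nat) \<Rightarrow> real \<Rightarrow> ereal" where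
  "poisson_rel_entropy M Y T =
     (let g = poisson_density M Y T;
          h = (\<lambda>k. g k * ln (g k) * pmf (poisson_pmf T) k)
      in if summable h then ereal (\<Sum>k. h k) else \<infinity>)"

end

theory Submission
  imports Defs "HOL-Analysis.FPS_Convergence" "HOL-Complex_Analysis.Cauchy_Integral_Formula"
    "HOL-Real_Asymp.Real_Asymp"
begin

unbundle no vec_syntax
unbundle fps_syntax

text \<open>
  Relative entropy is at most the chi-square distance, which is estimated through the Charlier
  expansion of the density. If \<open>G\<close> is the probability generating function of \<open>X\<close>, write
  \<open>G(1 + w) e\<^bsup>-Tw\<^esup> = B(w)\<close>; then \<open>B\<close> has constant term 1, no linear term (the mean is \<open>T\<close>), and
  quadratic coefficient \<open>(Var X - T) / 2\<close>. Thinning by \<open>1/n\<close> and adding \<open>n\<close> copies replaces \<open>B(w)\<close>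
  by \<open>B(w/n)\<^sup>n\<close>, whose quadratic coefficient is \<open>(Var X - T) / (2n)\<close>. The upper bound on \<open>f\<close> makes \<open>B\<close>
  dominated, coefficientwise, by a series of size at most \<open>e\<^bsup>D r^2\<^esup>\<close> at radius \<open>r\<close>, so
  \<open>B(w/n)\<^sup>n\<close> is dominated by \<open>e\<^bsup>D r^2 / n\<^esup>\<close> and all terms of degree at least 3 together
  contribute \<open>O(n\<^bsup>-3/2\<^esup>)\<close> in norm. The \<open>L\<^sup>2(\<pi>\<^sub>T)\<close> triangle inequality then bounds the chi-square
  distance by \<open>(Var X / T - 1)\<^sup>2 / (2 n\<^sup>2) + o(n\<^bsup>-2\<^esup>)\<close>.
\<close>

section \<open>Double series, power series coefficients and Poisson generating functions\<close>

lemma sums_swap: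
  fixes f :: "nat \<Rightarrow> nat \<Rightarrow> real"
  assumes r: "\<And>i. (\<lambda>j. f i j) sums r i"
    and s: "\<And>i. summable (\<lambda>j. \<bar>f i j\<bar>)" and "summable (\<lambda>i. \<Sum>j. \<bar>f i j\<bar>)"
  shows "summable (\<lambda>i. f i j)" and "summable r" and "(\<lambda>j. \<Sum>i. f i j) sums (\<Sum>i. r i)"
proof -
  \<comment> \<open>Inner sums become integrals over counting measure, so the interchange is
    termwise integration of a series of integrable functions.\<close>
  let ?N = "count_space (UNIV :: nat set)"
  have int: "integrable ?N (f i)" for i
    using s by (simp add: integrable_count_space_nat_iff)
  have le: "\<bar>f i j\<bar> \<le> (\<Sum>j. \<bar>f i j\<bar>)" for i j
    using sum_le_suminf[OF s[of i], of "{j}"] by simp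
  have sm: "summable (\<lambda>i. norm (f i j))" for j
    by (rule summable_comparison_test[OF _ assms(3)]) (use le in auto)
  show "summable (\<lambda>i. f i j)"
    by (rule summable_norm_cancel) (rule sm)
  have ri: "integral\<^sup>L ?N (f i) = r i" for i
    using sums_integral_count_space_nat[OF int[of i]] r[of i] sums_unique2 by blast
  have ni: "(\<integral>j. norm (f i j) \<partial>?N) = (\<Sum>j. \<bar>f i j\<bar>)" for i
    using integral_count_space_nat[of "\<lambda>j. norm (f i j)"] int by simp
  have sm2: "summable (\<lambda>i. (\<integral>j. norm (f i j) \<partial>?N))"
    unfolding ni using assms(3) .
  have AE: "AE j in ?N. summable (\<lambda>i. norm (f i j))"
    using sm by simp
  have a: "r sums (\<integral>j. (\<Sum>i. f i j) \<partial>?N)"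
    using sums_integral[OF int AE sm2] unfolding ri .
  then show "summable r" by (rule sums_summable)
  show "(\<lambda>j. \<Sum>i. f i j) sums (\<Sum>i. r i)"
    using sums_integral_count_space_nat[OF integrable_suminf[OF int AE sm2]]
    unfolding sums_unique[OF a, symmetric] .
qed

text \<open>Zeros of a nonconstant power series are isolated, while the difference of the two series
  vanishes on a whole neighbourhood of 0.\<close>

lemma powser_eq_coeffs:
  fixes a b :: "nat \<Rightarrow> real"
  assumes "0 < r"
    and a: "\<And>x. \<bar>x\<bar> < r \<Longrightarrow> (\<lambda>n. a n * x ^ n) sums f x"
    and b: "\<And>x. \<bar>x\<bar> < r \<Longrightarrow> (\<lambda>n. b n * x ^ n) sums f x"
  shows "a n = b n"
proof (rule ccontr)
  assume "a n \<noteq> b n"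
  have s: "(\<lambda>n. (a n - b n) * x ^ n) sums 0" if "\<bar>x\<bar> < r" for x
    using sums_diff[OF a[OF that] b[OF that]] by (simp add: algebra_simps)
  have "a 0 - b 0 = 0"
    using s[of 0] \<open>0 < r\<close> powser_sums_zero_iff[of "\<lambda>n. a n - b n"] by simp
  then have "n > 0"
    using \<open>a n \<noteq> b n\<close> by (cases n) auto
  have s': "(\<lambda>n. (a n - b n) * (x - 0) ^ n) sums 0" if "norm (x - 0) < r" for x
    using s[of x] that by simp
  obtain s' :: real where "0 < s'" "\<And>z. \<bar>z\<bar> \<le> s' \<and> z \<noteq> 0 \<Longrightarrow> False"
    using powser_0_nonzero[OF \<open>0 < r\<close> s' refl, of n] \<open>n > 0\<close> \<open>a n \<noteq> b n\<close> by auto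
  from this(2)[of s'] this(1) show False by auto
qed

text \<open>\<open>fact i * real (k choose i)\<close> is a falling factorial, so the sum is
  \<open>z ^ i\<close> times the i-th derivative of the Poisson generating function; at
  \<open>z = 1\<close> it is the factorial moment \<open>T ^ i\<close>.\<close>

lemma poisson_binomial_sums:
  assumes "T > 0"
  shows "(\<lambda>k. pmf (poisson_pmf T) k * (fact i * real (k choose i)) * z ^ k)
    sums ((T * z) ^ i * exp (T * (z - 1)))"
proof -
  have "(\<lambda>m. (T * z) ^ m /\<^sub>R fact m) sums exp (T * z)"
    by (rule exp_converges)
  then have "(\<lambda>m. (T * z) ^ i * exp (- T) * ((T * z) ^ m /\<^sub>R fact m))
      sums ((T * z) ^ i * exp (- T) * exp (T * z))"
    by (rule sums_mult)
  moreover have "exp (- T) * exp (T * z) = exp (T * (z - 1))"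
    by (simp add: mult_exp_exp algebra_simps)
  ultimately have 1: "(\<lambda>m. (T * z) ^ i * exp (- T) * ((T * z) ^ m /\<^sub>R fact m))
      sums ((T * z) ^ i * exp (T * (z - 1)))"
    by (simp add: mult.assoc)
  let ?f = "\<lambda>k. pmf (poisson_pmf T) k * (fact i * real (k choose i)) * z ^ k"
  have "?f (m + i) = (T * z) ^ i * exp (- T) * ((T * z) ^ m /\<^sub>R fact m)" for m
    using assms by (simp add: binomial_fact power_add power_mult_distrib divide_simps)
  with 1 have "(\<lambda>m. ?f (m + i)) sums ((T * z) ^ i * exp (T * (z - 1)))"
    by simp
  moreover have "?f k = 0" if "k < i" for k
    using that by (simp add: binomial_eq_0)
  ultimately show ?thesis
    by (subst (asm) sums_zero_iff_shift) auto
qed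

lemma poisson_pgf_sums:
  assumes "T > 0"
  shows "(\<lambda>k. pmf (poisson_pmf T) k * z ^ k) sums exp (T * (z - 1))"
  using poisson_binomial_sums[OF assms, of 0 z] by simp

section \<open>Charlier polynomials\<close>

text \<open>
  Normalised so that their generating function against the Poisson weights is
  \<open>(z - 1)\<^sup>j e\<^bsup>T(z - 1)\<^esup>\<close>, which is the \<open>j\<close>-th term of the expansion of a
  probability generating function around \<open>z = 1\<close>.
\<close>
definition charlier :: "real \<Rightarrow> nat \<Rightarrow> nat \<Rightarrow> real" where
  "charlier T j k =
     (\<Sum>i\<le>j. real (j choose i) * (- 1) ^ (j - i) / T ^ i * (fact i * real (k choose i)))"

lemma charlier_0 [simp]: "charlier T 0 k = 1"
  by (simp add: charlier_def)

text \<open>Each falling factorial contributes \<open>(T * z) ^ i\<close>, the division by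
  \<open>T ^ i\<close> cancels the powers of \<open>T\<close>, and the binomial theorem for
  \<open>z - 1\<close> remains.\<close>

lemma charlier_sums:
  assumes "T > 0"
  shows "(\<lambda>k. pmf (poisson_pmf T) k * charlier T j k * z ^ k)
    sums ((z - 1) ^ j * exp (T * (z - 1)))"
proof -
  let ?c = "\<lambda>i. real (j choose i) * (- 1) ^ (j - i) / T ^ i"
  have "(\<lambda>k. \<Sum>i\<le>j. ?c i * (pmf (poisson_pmf T) k * (fact i * real (k choose i)) * z ^ k))
      sums (\<Sum>i\<le>j. ?c i * ((T * z) ^ i * exp (T * (z - 1))))"
    by (intro sums_sum sums_mult poisson_binomial_sums assms)
  moreover have "(\<Sum>i\<le>j. ?c i * ((T * z) ^ i * exp (T * (z - 1)))) = (z - 1) ^ j * exp (T * (z - 1))"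
    using assms binomial_ring[of z "- 1 :: real" j]
    by (simp add: sum_distrib_left power_mult_distrib mult_ac)
  ultimately show ?thesis
    by (simp add: charlier_def sum_distrib_left sum_distrib_right mult_ac)
qed

text \<open>Dropping signs turns \<open>z - 1\<close> into \<open>z + 1\<close> in the binomial
  factor. The bound justifies exchanging the sums over degree and over points in
  \<open>charlier_expansion\<close>.\<close>

lemma charlier_abs_sums_le:
  assumes "T > 0" "z \<ge> 0"
  shows "summable (\<lambda>k. \<bar>pmf (poisson_pmf T) k * charlier T j k\<bar> * z ^ k)"
    and "(\<Sum>k. \<bar>pmf (poisson_pmf T) k * charlier T j k\<bar> * z ^ k) \<le> (z + 1) ^ j * exp (T * (z - 1))"
proof -
  let ?c = "\<lambda>i. real (j choose i) / T ^ i"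
  let ?g = "\<lambda>k. \<Sum>i\<le>j. ?c i * (pmf (poisson_pmf T) k * (fact i * real (k choose i)) * z ^ k)"
  have "?g sums (\<Sum>i\<le>j. ?c i * ((T * z) ^ i * exp (T * (z - 1))))"
    by (intro sums_sum sums_mult poisson_binomial_sums assms)
  moreover have "(\<Sum>i\<le>j. ?c i * ((T * z) ^ i * exp (T * (z - 1)))) = (z + 1) ^ j * exp (T * (z - 1))"
    using assms binomial_ring[of z "1 :: real" j]
    by (simp add: sum_distrib_left power_mult_distrib mult_ac)
  ultimately have g: "?g sums ((z + 1) ^ j * exp (T * (z - 1)))"
    by simp
  have le: "\<bar>pmf (poisson_pmf T) k * charlier T j k\<bar> * z ^ k \<le> ?g k" for k
  proof -
    have "\<bar>charlier T j k\<bar> \<le> (\<Sum>i\<le>j. \<bar>real (j choose i) * (- 1) ^ (j - i) / T ^ i * (fact i * real (k choose i))\<bar>)"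
      unfolding charlier_def by (rule sum_abs)
    also have "\<dots> = (\<Sum>i\<le>j. ?c i * (fact i * real (k choose i)))"
      using assms by (intro sum.cong refl) (simp add: abs_mult power_abs)
    finally have "pmf (poisson_pmf T) k * z ^ k * \<bar>charlier T j k\<bar> \<le>
        pmf (poisson_pmf T) k * z ^ k * (\<Sum>i\<le>j. ?c i * (fact i * real (k choose i)))"
      using assms by (intro mult_left_mono) auto
    then show ?thesis
      by (simp only: abs_mult abs_of_nonneg[OF pmf_nonneg] sum_distrib_left) (simp only: mult_ac)
  qed
  show 1: "summable (\<lambda>k. \<bar>pmf (poisson_pmf T) k * charlier T j k\<bar> * z ^ k)"
    by (rule summable_comparison_test[OF _ sums_summable[OF g]]) (use le assms in \<open>auto simp: abs_mult\<close>)
  show "(\<Sum>k. \<bar>pmf (poisson_pmf T) k * charlier T j k\<bar> * z ^ k) \<le> (z + 1) ^ j * exp (T * (z - 1))"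
    using suminf_le[OF le 1 sums_summable[OF g]] sums_unique[OF g] by simp
qed

section \<open>Norms of Charlier polynomials in L2 of the Poisson measure\<close>

lemma L2_set_sum_le:
  "L2_set (\<lambda>k. \<Sum>j\<in>J. f j k) A \<le> (\<Sum>j\<in>J. L2_set (f j) A)"
proof (induction J rule: infinite_finite_induct)
  case (insert x F)
  then show ?case
    using L2_set_triangle_ineq[of "f x" "\<lambda>k. \<Sum>j\<in>F. f j k" A] by simp
qed (auto simp: L2_set_0')

lemma L2_set_scale: "L2_set (\<lambda>k. c * f k) A = \<bar>c\<bar> * L2_set f A" for c :: real
  unfolding L2_set_def by (simp add: power_mult_distrib sum_distrib_left[symmetric] real_sqrt_mult)

text \<open>
  A falling factorial is dominated by a geometric sequence, \<open>(k)\<^sub>i \<le> i! s\<^bsup>-i\<^esup> (1 + s)\<^sup>k\<close>; the choice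
  \<open>s = \<surd>i\<close> gives the growth \<open>\<surd>(i!)\<close> up to geometric factors.
\<close>
lemma L2_falling_le:
  assumes T: "T > 0"
  shows "L2_set (\<lambda>k. sqrt (pmf (poisson_pmf T) k) * (fact i * real (k choose i))) {..<K}
    \<le> (sqrt (real i) * exp (2 * T)) ^ i"
proof -
  let ?s = "sqrt (real i)"
  have ff: "fact i * real (k choose i) \<le> ?s ^ i * (1 + ?s) ^ k" for k
  proof (cases "i = 0")
    case False
    then have s: "?s > 0" by simp
    have "real (k choose i) * ?s ^ i \<le> (\<Sum>j\<le>k. real (k choose j) * ?s ^ j * 1 ^ (k - j))"
    proof (cases "i \<le> k")
      case True
      then have "real (k choose i) * ?s ^ i * 1 ^ (k - i) \<le> (\<Sum>j\<le>k. real (k choose j) * ?s ^ j * 1 ^ (k - j))"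
        by (intro member_le_sum) auto
      then show ?thesis by simp
    qed (auto intro!: sum_nonneg simp: binomial_eq_0)
    also have "\<dots> = (1 + ?s) ^ k"
      by (simp add: binomial_ring add.commute[of 1])
    finally have 1: "real (k choose i) * ?s ^ i \<le> (1 + ?s) ^ k" .
    have "fact i \<le> real (i ^ i)"
      by (rule fact_le_power)
    also have "\<dots> = ?s ^ i * ?s ^ i"
      by (simp add: power_mult_distrib[symmetric])
    finally have "fact i * real (k choose i) \<le> ?s ^ i * ?s ^ i * real (k choose i)"
      by (rule mult_right_mono) auto
    also have "\<dots> = ?s ^ i * (real (k choose i) * ?s ^ i)" by simp
    also have "\<dots> \<le> ?s ^ i * (1 + ?s) ^ k"
      by (rule mult_left_mono[OF 1]) auto
    finally show ?thesis .
  qed auto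
  \<comment> \<open>After squaring the geometric bound, its Poisson mean is the generating function
    evaluated at \<open>?z\<close>.\<close>
  let ?z = "(1 + ?s)\<^sup>2"
  have "(\<Sum>k<K. (sqrt (pmf (poisson_pmf T) k) * (fact i * real (k choose i)))\<^sup>2)
      \<le> (\<Sum>k<K. real i ^ i * (pmf (poisson_pmf T) k * ?z ^ k))"
  proof (intro sum_mono)
    fix k
    have "(fact i * real (k choose i))\<^sup>2 \<le> (?s ^ i * (1 + ?s) ^ k)\<^sup>2"
      by (rule power_mono[OF ff]) auto
    also have "\<dots> = real i ^ i * ?z ^ k"
      by (simp add: power_mult_distrib power_mult[symmetric] mult.commute[of _ 2])
         (simp add: power_mult)
    finally have "pmf (poisson_pmf T) k * (fact i * real (k choose i))\<^sup>2
        \<le> pmf (poisson_pmf T) k * (real i ^ i * ?z ^ k)"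
      by (rule mult_left_mono) auto
    then show "(sqrt (pmf (poisson_pmf T) k) * (fact i * real (k choose i)))\<^sup>2
        \<le> real i ^ i * (pmf (poisson_pmf T) k * ?z ^ k)"
      by (simp only: power_mult_distrib real_sqrt_pow2[OF pmf_nonneg] mult_ac)
  qed
  also have "\<dots> = real i ^ i * (\<Sum>k<K. pmf (poisson_pmf T) k * ?z ^ k)"
    by (simp only: sum_distrib_left)
  also have "\<dots> \<le> real i ^ i * exp (T * (?z - 1))"
    using sum_le_suminf[OF sums_summable[OF poisson_pgf_sums[OF T, of ?z]], of "{..<K}"]
      sums_unique[OF poisson_pgf_sums[OF T, of ?z]]
    by (intro mult_left_mono) auto
  \<comment> \<open>\<open>?z - 1 = 2 * ?s + real i\<close> with \<open>?s\<close> at most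
    \<open>real i\<close>; the constant 4 is chosen so that the result is the square of
    \<open>(?s * exp (2 * T)) ^ i\<close>.\<close>
  also have "\<dots> \<le> real i ^ i * exp (4 * T * real i)"
  proof -
    have "?s \<le> real i"
      by (cases "i = 0") (auto intro!: real_le_lsqrt simp: power2_eq_square)
    then have "?z - 1 \<le> 4 * real i"
      by (simp add: power2_eq_square algebra_simps)
    then have "T * (?z - 1) \<le> T * (4 * real i)"
      using T by (intro mult_left_mono) auto
    then show ?thesis
      by (intro mult_left_mono) (auto simp: mult_ac)
  qed
  also have "\<dots> = ((?s * exp (2 * T)) ^ i)\<^sup>2"
  proof -
    have "((?s * exp (2 * T)) ^ i)\<^sup>2 = (?s\<^sup>2 * (exp (2 * T))\<^sup>2) ^ i"
      by (simp only: power_mult_distrib power_mult[symmetric] mult.commute[of _ 2])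
    also have "\<dots> = real i ^ i * exp (4 * T * real i)"
      by (simp add: power_mult_distrib exp_of_nat_mult[symmetric] exp_double[symmetric] mult_ac)
    finally show ?thesis by simp
  qed
  finally show ?thesis
    unfolding L2_set_def by (intro real_le_lsqrt) auto
qed

text \<open>Once \<open>sqrt i\<close> is replaced by \<open>sqrt j\<close>, the triangle inequality
  yields a binomial sum. The growth \<open>sqrt j ^ j\<close> is what the decay in
  \<open>coef_le\<close> compensates. Norms are truncated to \<open>{..<K}\<close>, with bounds
  uniform in \<open>K\<close>.\<close>

lemma L2_charlier_le:
  assumes T: "T > 0" and j: "j \<ge> 1"
  shows "L2_set (\<lambda>k. sqrt (pmf (poisson_pmf T) k) * charlier T j k) {..<K}
    \<le> ((1 + exp (2 * T) / T) * sqrt (real j)) ^ j"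
proof -
  let ?c = "\<lambda>i. real (j choose i) * (- 1) ^ (j - i) / T ^ i"
  let ?f = "\<lambda>i k. sqrt (pmf (poisson_pmf T) k) * (fact i * real (k choose i))"
  have "L2_set (\<lambda>k. sqrt (pmf (poisson_pmf T) k) * charlier T j k) {..<K}
      = L2_set (\<lambda>k. \<Sum>i\<le>j. ?c i * ?f i k) {..<K}"
    by (simp add: charlier_def sum_distrib_left mult_ac)
  also have "\<dots> \<le> (\<Sum>i\<le>j. L2_set (\<lambda>k. ?c i * ?f i k) {..<K})"
    by (rule L2_set_sum_le)
  also have "\<dots> = (\<Sum>i\<le>j. \<bar>?c i\<bar> * L2_set (?f i) {..<K})"
    by (simp only: L2_set_scale)
  also have "\<dots> \<le> (\<Sum>i\<le>j. real (j choose i) * (sqrt (real j) * exp (2 * T) / T) ^ i * 1 ^ (j - i))"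
  proof (rule sum_mono)
    fix i assume "i \<in> {..j}"
    then have "(sqrt (real i) * exp (2 * T)) ^ i \<le> (sqrt (real j) * exp (2 * T)) ^ i"
      by (intro power_mono mult_right_mono) auto
    with L2_falling_le[OF T, of i K] have "\<bar>?c i\<bar> * L2_set (?f i) {..<K} \<le> \<bar>?c i\<bar> * (sqrt (real j) * exp (2 * T)) ^ i"
      by (intro mult_left_mono) auto
    moreover have "\<bar>?c i\<bar> = real (j choose i) / T ^ i"
      using T by (simp add: abs_mult power_abs)
    ultimately show "\<bar>?c i\<bar> * L2_set (?f i) {..<K} \<le> real (j choose i) * (sqrt (real j) * exp (2 * T) / T) ^ i * 1 ^ (j - i)"
      by (simp only: power_divide power_one mult_1_right times_divide_eq_left times_divide_eq_right)
  qed
  also have "\<dots> = (sqrt (real j) * exp (2 * T) / T + 1) ^ j"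
    by (simp add: binomial_ring)
  also have "\<dots> \<le> ((1 + exp (2 * T) / T) * sqrt (real j)) ^ j"
    using j T by (intro power_mono) (auto simp: algebra_simps)
  finally show ?thesis .
qed

text \<open>Degree 2 determines the leading term, so the crude bound of
  \<open>L2_charlier_le\<close> is too weak here; over all points the squared norm is exactly
  \<open>2 / T ^ 2\<close>.\<close>

lemma L2_charlier_2_le:
  assumes T: "T > 0"
  shows "L2_set (\<lambda>k. sqrt (pmf (poisson_pmf T) k) * charlier T 2 k) {..<K} \<le> sqrt 2 / T"
proof -
  let ?p = "pmf (poisson_pmf T)"
  let ?F = "\<lambda>i k. fact i * real (k choose i)"
  have F: "?F 0 k = 1" "?F 1 k = real k" "?F 2 k = real k * (real k - 1)"
    "?F 3 k = real k * (real k - 1) * (real k - 2)"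
    "?F 4 k = real k * (real k - 1) * (real k - 2) * (real k - 3)" for k
    by (simp_all add: binomial_gbinomial gbinomial_prod_rev numeral_eq_Suc)
  have m: "(\<lambda>k. ?p k * ?F i k) sums T ^ i" for i
    using poisson_binomial_sums[OF T, of i 1] by simp
  have c: "charlier T 2 k = 1 - 2 * real k / T + real k * (real k - 1) / T\<^sup>2" for k
    using F[of k] by (simp add: charlier_def numeral_2_eq_2 field_simps)
  \<comment> \<open>The square is expanded again in falling factorials, whose Poisson means are the
    powers \<open>T ^ i\<close>.\<close>
  have sq: "(charlier T 2 k)\<^sup>2 = ?F 4 k / T^4 + ?F 3 k * (4 / T^4 - 4 / T^3)
      + ?F 2 k * (2 / T^4 - 8 / T^3 + 6 / T^2) + ?F 1 k * (4 / T^2 - 4 / T) + ?F 0 k" for k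
    unfolding c F using T by (simp add: field_simps) (simp add: algebra_simps power_numeral_reduce power2_eq_square)?
  have "(\<lambda>k. (?p k * ?F 4 k) / T^4 + (?p k * ?F 3 k) * (4 / T^4 - 4 / T^3)
      + (?p k * ?F 2 k) * (2 / T^4 - 8 / T^3 + 6 / T^2) + (?p k * ?F 1 k) * (4 / T^2 - 4 / T)
      + ?p k * ?F 0 k) sums
    (T ^ 4 / T^4 + T ^ 3 * (4 / T^4 - 4 / T^3)
      + T ^ 2 * (2 / T^4 - 8 / T^3 + 6 / T^2) + T ^ 1 * (4 / T^2 - 4 / T) + T ^ 0)"
    by (intro sums_add sums_mult2 sums_divide m)
  moreover have "T ^ 4 / T^4 + T ^ 3 * (4 / T^4 - 4 / T^3)
      + T ^ 2 * (2 / T^4 - 8 / T^3 + 6 / T^2) + T ^ 1 * (4 / T^2 - 4 / T) + T ^ 0 = 2 / T^2"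
    using T by (simp add: field_simps power_numeral_reduce)
  ultimately have s: "(\<lambda>k. ?p k * (charlier T 2 k)\<^sup>2) sums (2 / T\<^sup>2)"
    unfolding sq by (simp only: distrib_left mult.assoc times_divide_eq_right)
  have "(\<Sum>k<K. (sqrt (?p k) * charlier T 2 k)\<^sup>2) = (\<Sum>k<K. ?p k * (charlier T 2 k)\<^sup>2)"
    by (simp only: power_mult_distrib real_sqrt_pow2[OF pmf_nonneg])
  also have "\<dots> \<le> 2 / T\<^sup>2"
    using sum_le_suminf[OF sums_summable[OF s], of "{..<K}"] sums_unique[OF s] by simp
  finally show ?thesis
    unfolding L2_set_def using T
    by (intro real_le_lsqrt) (auto simp: power_divide)
qed

section \<open>Coefficients of powers of power series\<close>

text \<open>Below 1 this is the second-order bound on the exponential, above 1 it is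
  \<open>x \<le> x ^ 2\<close>. It makes the exponential without its linear term quadratic in
  \<open>x\<close>.\<close>

lemma exp_le_add_exp_power2:
  fixes x :: real
  assumes "0 \<le> x"
  shows "exp x \<le> x + exp (x\<^sup>2)"
proof (cases "x \<le> 1")
  case True
  then show ?thesis
    using exp_bound[OF assms] exp_ge_add_one_self[of "x\<^sup>2"] by linarith
next
  case False
  then have "exp x \<le> exp (x\<^sup>2)"
    by (simp add: power2_eq_square)
  then show ?thesis using assms by linarith
qed

text \<open>The sum of absolute coefficients weighted by \<open>r ^ j\<close> is submultiplicative
  under the Cauchy product.\<close>

lemma fps_power_majorant:
  fixes B :: "real fps"
  assumes r: "0 \<le> r" and M: "\<And>J. (\<Sum>j\<le>J. \<bar>B $ j\<bar> * r ^ j) \<le> M"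
  shows "(\<Sum>j\<le>J. \<bar>(B ^ n) $ j\<bar> * r ^ j) \<le> M ^ n"
proof (induction n)
  case 0
  have "(\<Sum>j\<le>J. \<bar>(1 :: real fps) $ j\<bar> * r ^ j) = (\<Sum>j\<le>J. if j = 0 then 1 else 0)"
    by (intro sum.cong) auto
  then show ?case by simp
next
  case (Suc n)
  let ?a = "\<lambda>j. \<bar>B $ j\<bar> * r ^ j" and ?p = "\<lambda>j. \<bar>(B ^ n) $ j\<bar> * r ^ j"
  have nn: "0 \<le> ?a j" "0 \<le> ?p j" for j
    using r by auto
  have "(\<Sum>j\<le>J. \<bar>(B ^ Suc n) $ j\<bar> * r ^ j) \<le> (\<Sum>j\<le>J. \<Sum>i\<le>j. ?a i * ?p (j - i))"
  proof (rule sum_mono)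
    fix j
    have "\<bar>(B ^ Suc n) $ j\<bar> \<le> (\<Sum>i\<le>j. \<bar>B $ i * (B ^ n) $ (j - i)\<bar>)"
      unfolding power_Suc fps_mult_nth atMost_atLeast0 by (rule sum_abs)
    then have "\<bar>(B ^ Suc n) $ j\<bar> * r ^ j \<le> (\<Sum>i\<le>j. \<bar>B $ i * (B ^ n) $ (j - i)\<bar>) * r ^ j"
      using r by (intro mult_right_mono) auto
    also have "\<dots> = (\<Sum>i\<le>j. ?a i * ?p (j - i))"
      unfolding sum_distrib_right
    proof (rule sum.cong[OF refl])
      fix i assume "i \<in> {..j}"
      then have "r ^ j = r ^ i * r ^ (j - i)"
        by (simp add: power_add[symmetric])
      then show "\<bar>B $ i * (B ^ n) $ (j - i)\<bar> * r ^ j = ?a i * ?p (j - i)"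
        by (simp add: abs_mult)
    qed
    finally show "\<bar>(B ^ Suc n) $ j\<bar> * r ^ j \<le> (\<Sum>i\<le>j. ?a i * ?p (j - i))" .
  qed
  also have "\<dots> = (\<Sum>(i, j)\<in>{(i, j). i + j \<le> J}. ?a i * ?p j)"
    by (rule sum.triangle_reindex_eq[symmetric])
  \<comment> \<open>The triangle \<open>i + j \<le> J\<close> is enlarged to a square, over which
    the double sum factorizes.\<close>
  also have "\<dots> \<le> (\<Sum>(i, j)\<in>{..J} \<times> {..J}. ?a i * ?p j)"
    using nn by (intro sum_mono2) auto
  also have "\<dots> = (\<Sum>i\<le>J. ?a i) * (\<Sum>j\<le>J. ?p j)"
    by (simp only: sum_product sum.cartesian_product)
  also have "\<dots> \<le> M * M ^ n"
    using M[of J] Suc nn by (intro mult_mono) (auto intro!: sum_nonneg order_trans[OF _ M[of J]])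
  finally show ?case by simp
qed

lemma fps_power_nth_012:
  fixes B :: "'a :: comm_ring_1 fps"
  assumes "B $ 0 = 1" "B $ 1 = 0"
  shows "(B ^ n) $ 0 = 1" "(B ^ n) $ 1 = 0" "(B ^ n) $ 2 = of_nat n * B $ 2"
proof -
  have "(B ^ n) $ 0 = 1 \<and> (B ^ n) $ 1 = 0 \<and> (B ^ n) $ 2 = of_nat n * B $ 2"
    using assms
    by (induction n) (simp_all add: fps_mult_nth numeral_2_eq_2 atLeast0_atMost_Suc algebra_simps)
  then show "(B ^ n) $ 0 = 1" "(B ^ n) $ 1 = 0" "(B ^ n) $ 2 = of_nat n * B $ 2"
    by auto
qed

section \<open>Charlier coefficients of thinned sums\<close>

text \<open>\<open>C\<close> is a natural number because \<open>B_majorant\<close> uses it as the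
  exponent in Bernoulli's inequality.\<close>

locale poisson_dominated =
  fixes p :: "nat \<Rightarrow> real" and T :: real and C :: nat
  assumes T_pos: "T > 0" and C_ge_1: "C \<ge> 1"
    and p_nonneg: "0 \<le> p k"
    and p_le: "p k \<le> real C * pmf (poisson_pmf T) k"
    and p_sums: "p sums 1"
    and mean_sums: "(\<lambda>k. p k * real k) sums T"
begin

section \<open>Binomial moments and the generating function around 1\<close>

definition fmom :: "nat \<Rightarrow> real" where
  "fmom i = (\<Sum>k. p k * real (k choose i))"

definition pgf :: "real \<Rightarrow> real" where
  "pgf z = (\<Sum>k. p k * z ^ k)"

text \<open>
  The coefficients of \<open>B\<close> are the Charlier coefficients of the density of \<open>p\<close>.
\<close>
definition B :: "real fps" where
  "B = Abs_fps fmom * fps_exp (- T)"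

lemma pgf_summable: "z \<ge> 0 \<Longrightarrow> summable (\<lambda>k. p k * z ^ k)"
  by (rule summable_comparison_test[OF _ summable_mult[OF sums_summable[OF poisson_pgf_sums[OF T_pos, of z]], of "real C"]])
    (use p_nonneg in \<open>auto intro!: exI[of _ 0] mult_right_mono p_le simp: mult.assoc[symmetric] abs_mult\<close>)

lemma fmom_bounds: "0 \<le> fmom i" "fmom i \<le> real C * (T ^ i / fact i)"
proof -
  have "(\<lambda>k. real C * (pmf (poisson_pmf T) k * real (k choose i))) sums (real C * (T ^ i / fact i))"
    using sums_mult[OF sums_divide[OF poisson_binomial_sums[OF T_pos, of i 1], of "fact i"], of "real C"]
    by simp
  note s = this
  have le: "p k * real (k choose i) \<le> real C * (pmf (poisson_pmf T) k * real (k choose i))" for k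
    using mult_right_mono[OF p_le[of k], of "real (k choose i)"] by (simp add: mult.assoc)
  have sm: "summable (\<lambda>k. p k * real (k choose i))"
    by (rule summable_comparison_test[OF _ sums_summable[OF s]])
      (use p_nonneg in \<open>auto intro!: exI[of _ 0] le simp: abs_mult\<close>)
  show "0 \<le> fmom i"
    unfolding fmom_def using p_nonneg by (intro suminf_nonneg sm) auto
  show "fmom i \<le> real C * (T ^ i / fact i)"
    unfolding fmom_def using suminf_le[OF le sm sums_summable[OF s]] sums_unique[OF s] by simp
qed

lemma fmom_0: "fmom 0 = 1" and fmom_1: "fmom 1 = T"
  unfolding fmom_def using sums_unique[OF p_sums] sums_unique[OF mean_sums] by simp_all

text \<open>Expand \<open>(1 + w) ^ k\<close> binomially and exchange the sums; the double sum of
  absolute values is \<open>pgf\<close> at 1 + |w|, finite by domination. Thus \<open>fmom\<close>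
  lists the Taylor coefficients of \<open>pgf\<close> at 1.\<close>

lemma fmom_sums: "(\<lambda>i. fmom i * w ^ i) sums pgf (1 + w)"
proof -
  let ?f = "\<lambda>k i. p k * real (k choose i) * w ^ i"
  have 0: "?f k i = 0" if "i \<notin> {..k}" for k i
    using that by (simp add: binomial_eq_0)
  have "(\<lambda>i. ?f k i) sums (\<Sum>i\<le>k. ?f k i)" for k
    by (intro sums_finite 0) auto
  moreover have "(\<Sum>i\<le>k. ?f k i) = p k * (1 + w) ^ k" for k
    by (simp add: binomial_ring[of w 1] add.commute[of 1] sum_distrib_left mult_ac)
  ultimately have r: "(\<lambda>i. ?f k i) sums (p k * (1 + w) ^ k)" for k
    by simp
  have "(\<lambda>i. \<bar>?f k i\<bar>) sums (\<Sum>i\<le>k. \<bar>?f k i\<bar>)" for k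
    using 0[of _ k] by (intro sums_finite) auto
  moreover have "(\<Sum>i\<le>k. \<bar>?f k i\<bar>) = p k * (1 + \<bar>w\<bar>) ^ k" for k
    using p_nonneg[of k]
    by (simp add: binomial_ring[of "\<bar>w\<bar>" 1] add.commute[of 1] sum_distrib_left abs_mult power_abs mult_ac)
  ultimately have s: "(\<lambda>i. \<bar>?f k i\<bar>) sums (p k * (1 + \<bar>w\<bar>) ^ k)" for k
    by simp
  have sm: "summable (\<lambda>k. \<Sum>i. \<bar>?f k i\<bar>)"
    using pgf_summable[of "1 + \<bar>w\<bar>"] unfolding sums_unique[OF s, symmetric] by simp
  note sw = sums_swap[OF r sums_summable[OF s] sm]
  have "(\<Sum>k. ?f k i) = fmom i * w ^ i" for i
  \<comment> \<open>Summability of the moment comes from division by \<open>w ^ i\<close>; for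
    \<open>w = 0\<close> only \<open>i = 0\<close> gives a nonzero term.\<close>
  proof (cases "w = 0")
    case False
    have "summable (\<lambda>k. ?f k i / w ^ i)"
      by (rule summable_divide[OF sw(1)])
    then have "summable (\<lambda>k. p k * real (k choose i))"
      using False by simp
    then show ?thesis
      unfolding fmom_def by (rule suminf_mult2[symmetric])
  next
    case True
    then show ?thesis
      by (cases i) (simp_all add: fmom_def)
  qed
  then show ?thesis
    using sw(3) by (simp add: pgf_def)
qed

lemma conv_radius_fmom: "fps_conv_radius (Abs_fps fmom) = \<infinity>"
  unfolding fps_conv_radius_def
  by (rule conv_radius_inftyI'') (use sums_summable[OF fmom_sums] in simp)

lemma conv_radius_B: "fps_conv_radius B = \<infinity>"
  using fps_conv_radius_mult[of "Abs_fps fmom" "fps_exp (- T)"] conv_radius_fmom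
  by (simp add: B_def)

lemma eval_B: "eval_fps B w = pgf (1 + w) * exp (- T * w)"
proof -
  have "eval_fps (Abs_fps fmom) w = pgf (1 + w)"
    unfolding eval_fps_def using sums_unique[OF fmom_sums[of w]] by simp
  then show ?thesis
    unfolding B_def by (subst eval_fps_mult) (simp_all add: conv_radius_fmom)
qed

lemma B_012: "B $ 0 = 1" "B $ 1 = 0" "B $ 2 = fmom 2 - T\<^sup>2 / 2"
  using fmom_0 fmom_1
  by (simp_all add: B_def fps_mult_nth numeral_2_eq_2 atLeast0_atMost_Suc field_simps)

text \<open>The two factors of \<open>B\<close> are dominated coefficientwise by the series of C
  e^(Tw) and e^(Tw), whose product is C e^(2Tw).\<close>

lemma B_abs_le: "\<bar>B $ j\<bar> \<le> real C * ((2 * T) ^ j / fact j)"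
proof -
  have "\<bar>B $ j\<bar> \<le> (\<Sum>i\<le>j. \<bar>fmom i * ((- T) ^ (j - i) / fact (j - i))\<bar>)"
    unfolding B_def fps_mult_nth atMost_atLeast0 by (rule order_trans[OF sum_abs]) simp
  also have "\<dots> \<le> (\<Sum>i\<le>j. real C * (T ^ i / fact i) * (T ^ (j - i) / fact (j - i)))"
  proof (intro sum_mono)
    fix i
    have "\<bar>fmom i * ((- T) ^ (j - i) / fact (j - i))\<bar> = fmom i * (T ^ (j - i) / fact (j - i))"
      using fmom_bounds(1)[of i] T_pos by (simp add: abs_mult power_abs)
    also have "\<dots> \<le> real C * (T ^ i / fact i) * (T ^ (j - i) / fact (j - i))"
      using T_pos by (intro mult_right_mono fmom_bounds) auto
    finally show "\<bar>fmom i * ((- T) ^ (j - i) / fact (j - i))\<bar>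
        \<le> real C * (T ^ i / fact i) * (T ^ (j - i) / fact (j - i))" .
  qed
  also have "\<dots> = real C * (\<Sum>i\<le>j. real (j choose i) * T ^ i * T ^ (j - i) / fact j)"
    unfolding sum_distrib_left by (intro sum.cong refl) (simp add: binomial_fact)
  also have "\<dots> = real C * ((2 * T) ^ j / fact j)"
    unfolding sum_divide_distrib[symmetric] binomial_ring[symmetric] mult_2 ..
  finally show ?thesis .
qed

text \<open>
  Since \<open>B $ 1 = 0\<close>, the exponent is quadratic in \<open>r\<close>, so rescaling \<open>r\<close> by \<open>1 / n\<close> and
  taking \<open>n\<close>-th powers gains a factor \<open>1 / n\<close> in \<open>coef_majorant\<close>.
\<close>
lemma B_majorant:
  assumes r: "0 \<le> r"
  shows "(\<Sum>j\<le>J. \<bar>B $ j\<bar> * r ^ j) \<le> exp (4 * real C * T\<^sup>2 * r\<^sup>2)"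
proof -
  let ?x = "2 * T * r"
  have x: "0 \<le> ?x" using r T_pos by simp
  have s: "(\<lambda>j. ?x ^ j /\<^sub>R fact j) sums exp ?x"
    by (rule exp_converges)
  \<comment> \<open>The exponential majorant is corrected in degrees 0 and 1, where the coefficients
    1 and 0 of \<open>B\<close> are known exactly.\<close>
  have t: "\<bar>B $ j\<bar> * r ^ j \<le> real C * (?x ^ j /\<^sub>R fact j) - (if j = 0 then real C - 1 else 0) - (if j = 1 then real C * ?x else 0)"
    for j
  proof -
    consider "j = 0" | "j = 1" | "j \<ge> 2" by linarith
    then show ?thesis
    proof cases
      case 3
      then show ?thesis
        using mult_right_mono[OF B_abs_le[of j], of "r ^ j"] r
        by (simp add: power_mult_distrib field_simps)
    qed (use B_012 in auto)
  qed
  have sum: "(\<lambda>j. real C * (?x ^ j /\<^sub>R fact j) - (if j = 0 then real C - 1 else 0) - (if j = 1 then real C * ?x else 0))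
      sums (real C * exp ?x - (real C - 1) - real C * ?x)"
    by (intro sums_diff sums_mult s) (use sums_single[of 0 "\<lambda>_. real C - 1"] sums_single[of 1 "\<lambda>_. real C * ?x"] in auto)
  have nn: "0 \<le> real C * (?x ^ j /\<^sub>R fact j) - (if j = 0 then real C - 1 else 0) - (if j = 1 then real C * ?x else 0)" for j
    using t[of j] r by (meson abs_ge_zero mult_nonneg_nonneg order_trans zero_le_power)
  have "(\<Sum>j\<le>J. \<bar>B $ j\<bar> * r ^ j) \<le> (\<Sum>j\<le>J. real C * (?x ^ j /\<^sub>R fact j) - (if j = 0 then real C - 1 else 0) - (if j = 1 then real C * ?x else 0))"
    by (rule sum_mono[OF t])
  also have "\<dots> \<le> real C * exp ?x - (real C - 1) - real C * ?x"
    unfolding sums_unique[OF sum] by (intro sum_le_suminf sums_summable[OF sum] nn) auto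
  also have "\<dots> = 1 + real C * (exp ?x - ?x - 1)"
    by (simp add: algebra_simps)
  also have "\<dots> \<le> 1 + real C * (exp (?x\<^sup>2) - 1)"
    using exp_le_add_exp_power2[OF x] by (intro add_left_mono mult_left_mono) linarith+
  \<comment> \<open>Moving \<open>C\<close> into the exponent avoids a constant prefactor, which
    would grow exponentially in n when n-th powers are taken.\<close>
  also have "\<dots> \<le> (1 + (exp (?x\<^sup>2) - 1)) ^ C"
    by (rule Bernoulli_inequality) (simp add: order_trans[OF _ exp_ge_zero])
  also have "\<dots> = exp (4 * real C * T\<^sup>2 * r\<^sup>2)"
    by (simp add: exp_of_nat_mult[symmetric] power_mult_distrib mult_ac)
  finally show ?thesis .
qed

text \<open>The Charlier coefficients of the law of the thinned sum.\<close>
definition coef :: "nat \<Rightarrow> nat \<Rightarrow> real" where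
  "coef n j = (B ^ n) $ j / real n ^ j"

lemma coef_majorant:
  assumes n: "n \<ge> 1" and r: "0 \<le> r"
  shows "(\<Sum>j\<le>J. \<bar>coef n j\<bar> * r ^ j) \<le> exp (4 * real C * T\<^sup>2 * r\<^sup>2 / real n)"
proof -
  let ?r = "r / real n"
  have "(\<Sum>j\<le>J. \<bar>coef n j\<bar> * r ^ j) = (\<Sum>j\<le>J. \<bar>(B ^ n) $ j\<bar> * ?r ^ j)"
    by (simp add: coef_def power_divide)
  also have "\<dots> \<le> exp (4 * real C * T\<^sup>2 * ?r\<^sup>2) ^ n"
    using r by (intro fps_power_majorant B_majorant) auto
  also have "\<dots> = exp (4 * real C * T\<^sup>2 * r\<^sup>2 / real n)"
    using n by (simp add: exp_of_nat_mult[symmetric] power_divide power2_eq_square)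
  finally show ?thesis .
qed

lemma coef_abs_summable:
  assumes n: "n \<ge> 1" and r: "0 \<le> r"
  shows "summable (\<lambda>j. \<bar>coef n j\<bar> * r ^ j)"
  using r by (intro bounded_imp_summable[OF _ coef_majorant[OF n r]]) auto

text \<open>The radius \<open>r = \<surd>(n j)\<close> balances the two factors of the Cauchy-type estimate.\<close>
lemma coef_le:
  assumes n: "n \<ge> 1" and j: "j \<ge> 1"
  shows "\<bar>coef n j\<bar> * (sqrt (real n) * sqrt (real j)) ^ j \<le> exp (4 * real C * T\<^sup>2) ^ j"
proof -
  let ?r = "sqrt (real n) * sqrt (real j)"
  have "\<bar>coef n j\<bar> * ?r ^ j \<le> (\<Sum>j\<le>j. \<bar>coef n j\<bar> * ?r ^ j)"
    by (rule member_le_sum) auto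
  also have "\<dots> \<le> exp (4 * real C * T\<^sup>2 * ?r\<^sup>2 / real n)"
    by (rule coef_majorant[OF n]) auto
  also have "\<dots> = exp (4 * real C * T\<^sup>2) ^ j"
    using n by (simp add: exp_of_nat_mult[symmetric] power_mult_distrib mult_ac)
  finally show ?thesis .
qed

lemma coef_012:
  assumes "n \<ge> 1"
  shows "coef n 0 = 1" "coef n 1 = 0" "coef n 2 = B $ 2 / real n"
  using fps_power_nth_012[OF B_012(1,2), of n] assms
  by (simp_all add: coef_def power2_eq_square)

section \<open>Charlier expansion of the density of the thinned sum\<close>

lemma coef_sums:
  assumes n: "n \<ge> 1"
  shows "(\<lambda>j. coef n j * w ^ j) sums (pgf (1 + w / real n) ^ n * exp (- T * w))"
proof -
  let ?w = "w / real n"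
  have inf: "fps_conv_radius (B ^ n) = \<infinity>"
    using fps_conv_radius_power[of B n] conv_radius_B by simp
  have "(\<lambda>j. (B ^ n) $ j * ?w ^ j) sums eval_fps (B ^ n) ?w"
    by (rule sums_eval_fps) (simp add: inf)
  also have "eval_fps (B ^ n) ?w = (pgf (1 + ?w) * exp (- T * ?w)) ^ n"
    by (simp add: eval_fps_power conv_radius_B eval_B)
  also have "\<dots> = pgf (1 + ?w) ^ n * exp (- T * w)"
    using n by (simp add: power_mult_distrib exp_of_nat_mult[symmetric])
  finally show ?thesis
    by (simp add: coef_def power_divide)
qed

text \<open>Multiplied by the Poisson weights and summed against \<open>z ^ k\<close>, the expansion
  becomes the series of \<open>coef_sums\<close> at \<open>w = z - 1\<close>, hence the generating
  function of \<open>q\<close>; coefficients are then compared.\<close>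

lemma charlier_expansion:
  assumes n: "n \<ge> 1"
    and q: "\<And>z. \<bar>z\<bar> < 1 \<Longrightarrow> (\<lambda>k. q k * z ^ k) sums (pgf (1 + (z - 1) / real n) ^ n)"
  shows "(\<lambda>j. coef n j * charlier T j k) sums (q k / pmf (poisson_pmf T) k)"
proof -
  let ?p = "pmf (poisson_pmf T)"
  let ?f = "\<lambda>z j k. coef n j * (?p k * charlier T j k * z ^ k)"
  let ?a = "\<lambda>k. \<Sum>j. coef n j * (?p k * charlier T j k)"
  have r: "(\<lambda>k. ?f z j k) sums (coef n j * ((z - 1) ^ j * exp (T * (z - 1))))" for z j
    by (intro sums_mult charlier_sums T_pos)
  have eq: "\<bar>?f z j k\<bar> = \<bar>coef n j\<bar> * (\<bar>?p k * charlier T j k\<bar> * \<bar>z\<bar> ^ k)" for z j k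
    by (simp add: abs_mult power_abs)
  have s: "summable (\<lambda>k. \<bar>?f z j k\<bar>)" for z j
    unfolding eq by (intro summable_mult charlier_abs_sums_le T_pos) auto
  have b: "(\<Sum>k. \<bar>?f z j k\<bar>) \<le> \<bar>coef n j\<bar> * (\<bar>z\<bar> + 1) ^ j * exp (T * (\<bar>z\<bar> - 1))" for z :: real and j
  proof -
    note le = charlier_abs_sums_le[OF T_pos, of "\<bar>z\<bar>" j]
    have "(\<Sum>k. \<bar>?f z j k\<bar>) = \<bar>coef n j\<bar> * (\<Sum>k. \<bar>?p k * charlier T j k\<bar> * \<bar>z\<bar> ^ k)"
      unfolding eq by (rule suminf_mult[OF le(1)]) auto
    also have "\<dots> \<le> \<bar>coef n j\<bar> * ((\<bar>z\<bar> + 1) ^ j * exp (T * (\<bar>z\<bar> - 1)))"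
      by (intro mult_left_mono le(2)) auto
    finally show ?thesis by (simp only: mult.assoc)
  qed
  \<comment> \<open>The majorant is the coefficient series at radius |z| + 1, which converges at
    every radius.\<close>
  have sm: "summable (\<lambda>j. \<Sum>k. \<bar>?f z j k\<bar>)" for z
  proof (rule summable_comparison_test[OF _ summable_mult2[OF coef_abs_summable[OF n, of "\<bar>z\<bar> + 1"]]])
    have "norm (\<Sum>k. \<bar>?f z j k\<bar>) = (\<Sum>k. \<bar>?f z j k\<bar>)" for j
      using suminf_nonneg[OF s[where z=z and j=j]] by simp
    then show "\<exists>N. \<forall>j\<ge>N. norm (\<Sum>k. \<bar>?f z j k\<bar>) \<le> \<bar>coef n j\<bar> * (\<bar>z\<bar> + 1) ^ j * exp (T * (\<bar>z\<bar> - 1))"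
      using b by simp
  qed auto
  have sw: "summable (\<lambda>j. ?f z j k)"
    "(\<lambda>k. \<Sum>j. ?f z j k) sums (\<Sum>j. coef n j * ((z - 1) ^ j * exp (T * (z - 1))))" for z k
    by (rule sums_swap[OF r s sm])+
  \<comment> \<open>At \<open>z = 1\<close> the factor \<open>z ^ k\<close> disappears.\<close>
  have sa: "summable (\<lambda>j. coef n j * (?p k * charlier T j k))" for k
    using sw(1)[where z=1] by simp
  have "(\<lambda>k. ?a k * z ^ k) sums (pgf (1 + (z - 1) / real n) ^ n)" for z
  proof -
    have "(\<lambda>j. coef n j * ((z - 1) ^ j * exp (T * (z - 1))))
        sums (pgf (1 + (z - 1) / real n) ^ n)"
      using sums_mult2[OF coef_sums[OF n, of "z - 1"], of "exp (T * (z - 1))"]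
      by (simp add: mult.assoc mult_exp_exp)
    from sums_unique[OF this, symmetric] have "(\<lambda>k. \<Sum>j. ?f z j k) sums (pgf (1 + (z - 1) / real n) ^ n)"
      using sw(2)[where z=z] by (simp only:)
    moreover have "(\<Sum>j. ?f z j k) = ?a k * z ^ k" for k
      using suminf_mult2[OF sa[of k], of "z ^ k"] by (simp only: mult.assoc)
    ultimately show ?thesis by (simp only:)
  qed
  then have "?a k = q k"
    using powser_eq_coeffs[of 1 ?a "\<lambda>z. pgf (1 + (z - 1) / real n) ^ n" q] q by auto
  then have "(\<lambda>j. coef n j * (?p k * charlier T j k)) sums q k"
    using summable_sums[OF sa[of k]] by simp
  from sums_divide[OF this, of "?p k"] have "(\<lambda>j. coef n j * (?p k * charlier T j k) / ?p k) sums (q k / ?p k)" .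
  moreover have "?p k \<noteq> 0"
    using T_pos by simp
  then have "coef n j * (?p k * charlier T j k) / ?p k = coef n j * charlier T j k" for j
    by (simp only: mult.left_commute[of _ "?p k"] nonzero_mult_div_cancel_left not_False_eq_True)
  ultimately show ?thesis by (simp only:)
qed

section \<open>Chi-square estimate\<close>

definition ratio :: "nat \<Rightarrow> real" where
  "ratio n = (1 + exp (2 * T) / T) * exp (4 * real C * T\<^sup>2) / sqrt (real n)"

text \<open>The factor \<open>sqrt j ^ j\<close> in the norm of the polynomial cancels against the
  decay of the coefficient. What remains is geometric, with base \<open>ratio n\<close> of order
  n^(-1/2).\<close>

lemma coef_L2_charlier_le:
  assumes n: "n \<ge> 1" and j: "j \<ge> 1"
  shows "\<bar>coef n j\<bar> * L2_set (\<lambda>k. sqrt (pmf (poisson_pmf T) k) * charlier T j k) {..<K} \<le> ratio n ^ j"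
proof -
  let ?A = "1 + exp (2 * T) / T"
  have A: "?A > 0" using T_pos by (simp add: add_pos_pos)
  have "\<bar>coef n j\<bar> * L2_set (\<lambda>k. sqrt (pmf (poisson_pmf T) k) * charlier T j k) {..<K}
      \<le> \<bar>coef n j\<bar> * (?A * sqrt (real j)) ^ j"
    by (intro mult_left_mono L2_charlier_le T_pos j) auto
  also have "\<dots> = (?A / sqrt (real n)) ^ j * (\<bar>coef n j\<bar> * (sqrt (real n) * sqrt (real j)) ^ j)"
    using n by (simp add: power_mult_distrib power_divide)
  also have "\<dots> \<le> (?A / sqrt (real n)) ^ j * exp (4 * real C * T\<^sup>2) ^ j"
    using A by (intro mult_left_mono coef_le n j) auto
  also have "\<dots> = ratio n ^ j"
    by (simp add: ratio_def power_mult_distrib[symmetric])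
  finally show ?thesis .
qed

text \<open>Degree 0 is the subtracted 1 and degree 1 vanishes. Degree 2 gets the sharp norm; the
  higher degrees are bounded by a geometric series starting at \<open>ratio n ^ 3\<close>.\<close>

lemma chi_square_le:
  assumes n: "n \<ge> 1" and ratio: "ratio n < 1"
    and q: "\<And>z. \<bar>z\<bar> < 1 \<Longrightarrow> (\<lambda>k. q k * z ^ k) sums (pgf (1 + (z - 1) / real n) ^ n)"
  shows "(\<Sum>k<K. (q k / pmf (poisson_pmf T) k - 1)\<^sup>2 * pmf (poisson_pmf T) k)
    \<le> (\<bar>B $ 2\<bar> * sqrt 2 / (T * real n) + ratio n ^ 3 / (1 - ratio n))\<^sup>2"
proof -
  let ?p = "pmf (poisson_pmf T)" and ?g = "\<lambda>k. q k / pmf (poisson_pmf T) k"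
  let ?V = "\<bar>B $ 2\<bar> * sqrt 2 / (T * real n) + ratio n ^ 3 / (1 - ratio n)"
  let ?L = "\<lambda>j. L2_set (\<lambda>k. sqrt (?p k) * charlier T j k) {..<K}"
  have r0: "0 \<le> ratio n"
    using T_pos by (simp add: ratio_def)
  have exp: "(\<lambda>j. coef n (j + 2) * charlier T (j + 2) k) sums (?g k - 1)" for k
    using charlier_expansion[OF n q, of k] coef_012[OF n]
    by (subst sums_iff_shift) (simp_all add: numeral_2_eq_2)
  have part: "L2_set (\<lambda>k. \<Sum>j<J. sqrt (?p k) * (coef n (j + 2) * charlier T (j + 2) k)) {..<K} \<le> ?V" for J
  proof -
    have "L2_set (\<lambda>k. \<Sum>j<J. sqrt (?p k) * (coef n (j + 2) * charlier T (j + 2) k)) {..<K}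
        = L2_set (\<lambda>k. \<Sum>j<J. coef n (j + 2) * (sqrt (?p k) * charlier T (j + 2) k)) {..<K}"
      by (simp only: mult_ac)
    also have "\<dots> \<le> (\<Sum>j<J. L2_set (\<lambda>k. coef n (j + 2) * (sqrt (?p k) * charlier T (j + 2) k)) {..<K})"
      by (rule L2_set_sum_le)
    also have "\<dots> = (\<Sum>j<J. \<bar>coef n (j + 2)\<bar> * ?L (j + 2))"
      by (simp only: L2_set_scale)
    \<comment> \<open>With one term added, exactly \<open>J\<close> terms from degree 3 on remain
      after splitting off degree 2, also for \<open>J = 0\<close>.\<close>
    also have "\<dots> \<le> (\<Sum>j<Suc J. \<bar>coef n (j + 2)\<bar> * ?L (j + 2))"
      by simp
    also have "\<dots> = \<bar>coef n 2\<bar> * ?L 2 + (\<Sum>j<J. \<bar>coef n (j + 3)\<bar> * ?L (j + 3))"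
      by (simp only: sum.lessThan_Suc_shift) (simp add: eval_nat_numeral)
    also have "\<dots> \<le> \<bar>coef n 2\<bar> * (sqrt 2 / T) + (\<Sum>j<J. ratio n ^ (j + 3))"
      by (intro add_mono mult_left_mono sum_mono L2_charlier_2_le coef_L2_charlier_le n T_pos) auto
    also have "(\<Sum>j<J. ratio n ^ (j + 3)) = ratio n ^ 3 * (\<Sum>j<J. ratio n ^ j)"
      by (subst mult.commute) (simp only: power_add sum_distrib_right)
    also have "\<dots> \<le> ratio n ^ 3 * (1 / (1 - ratio n))"
      using r0 ratio sum_le_suminf[of "\<lambda>j. ratio n ^ j" "{..<J}"]
      by (intro mult_left_mono) (auto simp: suminf_geometric)
    finally show ?thesis
      using coef_012(3)[OF n] by (simp add: mult_ac)
  qed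
  \<comment> \<open>For fixed \<open>K\<close> the norm depends continuously on finitely many
    coordinates, so pointwise convergence suffices.\<close>
  have "(\<lambda>J. L2_set (\<lambda>k. \<Sum>j<J. sqrt (?p k) * (coef n (j + 2) * charlier T (j + 2) k)) {..<K})
      \<longlonglongrightarrow> L2_set (\<lambda>k. sqrt (?p k) * (?g k - 1)) {..<K}"
    unfolding L2_set_def using sums_mult[OF exp] unfolding sums_def
    by (intro tendsto_intros) auto
  then have "L2_set (\<lambda>k. sqrt (?p k) * (?g k - 1)) {..<K} \<le> ?V"
    by (rule LIMSEQ_le_const2) (use part in blast)
  then have "(L2_set (\<lambda>k. sqrt (?p k) * (?g k - 1)) {..<K})\<^sup>2 \<le> ?V\<^sup>2"
    by (intro power_mono) auto
  also have "(L2_set (\<lambda>k. sqrt (?p k) * (?g k - 1)) {..<K})\<^sup>2 = (\<Sum>k<K. (sqrt (?p k) * (?g k - 1))\<^sup>2)"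
    unfolding L2_set_def by (intro real_sqrt_pow2 sum_nonneg) auto
  also have "\<dots> = (\<Sum>k<K. (?g k - 1)\<^sup>2 * ?p k)"
    by (simp only: power_mult_distrib real_sqrt_pow2[OF pmf_nonneg] mult.commute)
  finally show ?thesis .
qed

lemma ratio_tendsto: "ratio \<longlonglongrightarrow> 0"
  unfolding ratio_def[abs_def] by real_asymp

lemma scaled_bound_tendsto:
  "(\<lambda>n. (real n * (\<bar>B $ 2\<bar> * sqrt 2 / (T * real n) + ratio n ^ 3 / (1 - ratio n)))\<^sup>2)
    \<longlonglongrightarrow> 2 * (B $ 2)\<^sup>2 / T\<^sup>2"
proof -
  let ?E = "(1 + exp (2 * T) / T) * exp (4 * real C * T\<^sup>2)"
  have inv: "(\<lambda>n. 1 / sqrt (real n)) \<longlonglongrightarrow> 0"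
    by real_asymp
  \<comment> \<open>Since \<open>ratio n ^ 3\<close> is \<open>?E ^ 3\<close> times n^(-3/2), the
    tail multiplied by \<open>n\<close> still decays like n^(-1/2).\<close>
  have "(\<lambda>n. ?E ^ 3 * (1 / sqrt (real n)) / (1 - ratio n)) \<longlonglongrightarrow> ?E ^ 3 * 0 / (1 - 0)"
    by (intro tendsto_intros inv ratio_tendsto) auto
  moreover have "eventually (\<lambda>n. ?E ^ 3 * (1 / sqrt (real n)) / (1 - ratio n) = real n * (ratio n ^ 3 / (1 - ratio n))) sequentially"
    using eventually_gt_at_top[of 0]
  proof eventually_elim
    case (elim n)
    have "sqrt (real n) ^ 3 = real n * sqrt (real n)"
      by (simp add: power3_eq_cube)
    then have "?E ^ 3 * (1 / sqrt (real n)) = real n * ratio n ^ 3"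
      using elim by (simp add: ratio_def power_divide)
    then show ?case by simp
  qed
  ultimately have "(\<lambda>n. real n * (ratio n ^ 3 / (1 - ratio n))) \<longlonglongrightarrow> 0"
    by (auto intro: Lim_transform_eventually)
  then have "(\<lambda>n. (\<bar>B $ 2\<bar> * sqrt 2 / T + real n * (ratio n ^ 3 / (1 - ratio n)))\<^sup>2)
      \<longlonglongrightarrow> (\<bar>B $ 2\<bar> * sqrt 2 / T + 0)\<^sup>2"
    by (intro tendsto_intros)
  moreover have "(\<bar>B $ 2\<bar> * sqrt 2 / T + 0)\<^sup>2 = 2 * (B $ 2)\<^sup>2 / T\<^sup>2"
    by (simp add: power_mult_distrib power_divide)
  moreover have "eventually (\<lambda>n. (\<bar>B $ 2\<bar> * sqrt 2 / T + real n * (ratio n ^ 3 / (1 - ratio n)))\<^sup>2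
      = (real n * (\<bar>B $ 2\<bar> * sqrt 2 / (T * real n) + ratio n ^ 3 / (1 - ratio n)))\<^sup>2) sequentially"
    using eventually_gt_at_top[of 0]
    by eventually_elim (simp add: distrib_left)
  ultimately show ?thesis
    by (auto intro: Lim_transform_eventually)
qed

end

section \<open>Relative entropy and chi-square distance\<close>

text \<open>Both bounds come from \<open>ln y \<le> y - 1\<close>, taken at \<open>y = 1 / x\<close>
  and at \<open>y = x\<close>.\<close>

lemma mult_ln_bounds:
  fixes x :: real
  assumes "x \<ge> 0"
  shows "x - 1 \<le> x * ln x" "x * ln x \<le> x * (x - 1)"
proof -
  have "x - 1 \<le> x * ln x \<and> x * ln x \<le> x * (x - 1)"
  proof (cases "x = 0")
    case False
    with assms have x: "x > 0" by simp
    have "x * ln (1 / x) \<le> x * (1 / x - 1)"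
      using x by (intro mult_left_mono ln_le_minus_one) auto
    moreover have "x * ln x \<le> x * (x - 1)"
      using x by (intro mult_left_mono ln_le_minus_one) auto
    ultimately show ?thesis
      using x by (simp add: ln_div right_diff_distrib)
  qed simp
  then show "x - 1 \<le> x * ln x" "x * ln x \<le> x * (x - 1)" by auto
qed

text \<open>With g = q / m, g (g - 1) = (g - 1)^2 + (g - 1), and g - 1 sums to zero against
  \<open>m\<close>.\<close>

lemma entropy_le_chi_square:
  fixes q m :: "nat \<Rightarrow> real"
  assumes m: "\<And>k. m k > 0" "m sums 1" and q: "\<And>k. q k \<ge> 0" "q sums 1"
    and W: "\<And>K. (\<Sum>k<K. (q k / m k - 1)\<^sup>2 * m k) \<le> W"
  shows "summable (\<lambda>k. q k / m k * ln (q k / m k) * m k)"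
    and "(\<Sum>k. q k / m k * ln (q k / m k) * m k) \<le> W"
proof -
  let ?g = "\<lambda>k. q k / m k"
  have g0: "?g k \<ge> 0" for k
    using q(1) m(1)[of k] by simp
  have gm: "?g k * m k = q k" for k
    using m(1)[of k] by simp
  have sm: "summable (\<lambda>k. (?g k - 1)\<^sup>2 * m k)"
    using m(1) W by (intro summableI_nonneg_bounded[of _ W]) (auto simp: less_imp_le)
  have up: "(\<lambda>k. (?g k - 1)\<^sup>2 * m k + q k - m k) sums ((\<Sum>k. (?g k - 1)\<^sup>2 * m k) + 1 - 1)"
    by (intro sums_diff sums_add summable_sums sm m q)
  have upper: "?g k * ln (?g k) * m k \<le> (?g k - 1)\<^sup>2 * m k + q k - m k" for k
  proof -
    have "?g k * ln (?g k) \<le> ?g k * (?g k - 1)"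
      by (rule mult_ln_bounds[OF g0])
    then have "?g k * ln (?g k) * m k \<le> ?g k * (?g k - 1) * m k"
      using m(1)[of k] by (intro mult_right_mono) auto
    also have "\<dots> = (?g k - 1)\<^sup>2 * m k + ?g k * m k - m k"
      by (simp only: power2_eq_square) algebra
    finally show ?thesis by (simp only: gm)
  qed
  have lower: "q k - m k \<le> ?g k * ln (?g k) * m k" for k
  proof -
    have "?g k - 1 \<le> ?g k * ln (?g k)"
      by (rule mult_ln_bounds[OF g0])
    then have "(?g k - 1) * m k \<le> ?g k * ln (?g k) * m k"
      using m(1)[of k] by (intro mult_right_mono) auto
    then show ?thesis by (simp only: left_diff_distrib gm mult_1)
  qed
  \<comment> \<open>Subtracting the lower bound makes the terms nonnegative, so the upper bound
    alone gives summability.\<close>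
  have "summable (\<lambda>k. ?g k * ln (?g k) * m k - (q k - m k))"
  proof (rule summable_comparison_test[OF _ summable_diff[OF sums_summable[OF up] sums_summable[OF sums_diff[OF q(2) m(2)]]]])
    show "\<exists>N. \<forall>k\<ge>N. norm (?g k * ln (?g k) * m k - (q k - m k)) \<le> (?g k - 1)\<^sup>2 * m k + q k - m k - (q k - m k)"
    proof (intro exI allI impI)
      fix k
      show "norm (?g k * ln (?g k) * m k - (q k - m k)) \<le> (?g k - 1)\<^sup>2 * m k + q k - m k - (q k - m k)"
        using upper[of k] lower[of k] unfolding real_norm_def by linarith
    qed
  qed
  from summable_add[OF this sums_summable[OF sums_diff[OF q(2) m(2)]]]
  show h: "summable (\<lambda>k. ?g k * ln (?g k) * m k)"
    by simp
  have "(\<Sum>k. ?g k * ln (?g k) * m k) \<le> (\<Sum>k. (?g k - 1)\<^sup>2 * m k)"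
    using suminf_le[OF upper h sums_summable[OF up]] sums_unique[OF up] by simp
  also have "\<dots> \<le> W"
    by (rule suminf_le_const[OF sm W])
  finally show "(\<Sum>k. ?g k * ln (?g k) * m k) \<le> W" .
qed

section \<open>Generating functions of thinnings\<close>

context prob_space
begin

text \<open>At each point only the term \<open>k = X \<omega>\<close> is nonzero, so the pieces add
  up to \<open>\<phi>\<close> and are integrated termwise.\<close>

lemma sums_partition:
  fixes \<phi> :: "'a \<Rightarrow> real" and X :: "'a \<Rightarrow> nat"
  assumes int: "\<And>k. integrable M (\<lambda>\<omega>. \<phi> \<omega> * indicator {\<omega> \<in> space M. X \<omega> = k} \<omega>)"
    and s: "summable (\<lambda>k. \<integral>\<omega>. \<bar>\<phi> \<omega> * indicator {\<omega> \<in> space M. X \<omega> = k} \<omega>\<bar> \<partial>M)"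
  shows "integrable M \<phi>"
    and "(\<lambda>k. \<integral>\<omega>. \<phi> \<omega> * indicator {\<omega> \<in> space M. X \<omega> = k} \<omega> \<partial>M) sums expectation \<phi>"
proof -
  let ?f = "\<lambda>k \<omega>. \<phi> \<omega> * indicator {\<omega> \<in> space M. X \<omega> = k} \<omega>"
  have fin: "?f k \<omega> = 0" if "k \<notin> {X \<omega>}" for k \<omega>
    using that by (auto simp: indicator_def)
  have AE: "AE \<omega> in M. summable (\<lambda>k. norm (?f k \<omega>))"
  proof (rule AE_I2)
    fix \<omega>
    show "summable (\<lambda>k. norm (?f k \<omega>))"
      by (rule summable_finite[of "{X \<omega>}"]) (use fin[of _ \<omega>] in auto)
  qed
  have eq: "(\<Sum>k. ?f k \<omega>) = \<phi> \<omega>" if "\<omega> \<in> space M" for \<omega>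
    using suminf_finite[of "{X \<omega>}" "\<lambda>k. ?f k \<omega>"] fin that by (simp add: indicator_def)
  have s': "summable (\<lambda>k. \<integral>\<omega>. norm (?f k \<omega>) \<partial>M)"
    using s by simp
  have "integrable M (\<lambda>\<omega>. \<Sum>k. ?f k \<omega>) \<longleftrightarrow> integrable M \<phi>"
    by (intro Bochner_Integration.integrable_cong refl eq)
  then show "integrable M \<phi>"
    using integrable_suminf[OF int AE s'] by blast
  have "(\<integral>\<omega>. (\<Sum>k. ?f k \<omega>) \<partial>M) = expectation \<phi>"
    by (intro Bochner_Integration.integral_cong refl eq)
  then show "(\<lambda>k. \<integral>\<omega>. ?f k \<omega> \<partial>M) sums expectation \<phi>"
    using sums_integral[OF int AE s'] by simp
qed

lemma prob_nat_sums:
  fixes X :: "'a \<Rightarrow> nat"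
  assumes X: "X \<in> M \<rightarrow>\<^sub>M count_space UNIV"
  shows "(\<lambda>k. prob {\<omega> \<in> space M. X \<omega> = k}) sums 1"
proof -
  have "(\<lambda>k. prob {\<omega> \<in> space M. X \<omega> = k}) sums prob (\<Union>k. {\<omega> \<in> space M. X \<omega> = k})"
    using X by (intro finite_measure_UNION) (auto simp: disjoint_family_on_def)
  also have "(\<Union>k. {\<omega> \<in> space M. X \<omega> = k}) = space M"
    by auto
  finally show ?thesis by (simp add: prob_space)
qed

lemma expectation_nat_sums:
  fixes X :: "'a \<Rightarrow> nat" and h :: "nat \<Rightarrow> real"
  assumes X: "X \<in> M \<rightarrow>\<^sub>M count_space UNIV"
    and s: "summable (\<lambda>k. \<bar>h k\<bar> * prob {\<omega> \<in> space M. X \<omega> = k})"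
  shows "integrable M (\<lambda>\<omega>. h (X \<omega>))"
    and "(\<lambda>k. h k * prob {\<omega> \<in> space M. X \<omega> = k}) sums expectation (\<lambda>\<omega>. h (X \<omega>))"
proof -
  let ?A = "\<lambda>k. {\<omega> \<in> space M. X \<omega> = k}"
  have A: "?A k \<in> events" for k
    using X by measurable
  have eq: "h (X \<omega>) * indicator (?A k) \<omega> = h k * indicator (?A k) \<omega>" for k \<omega>
    by (auto simp: indicator_def)
  have int: "integrable M (\<lambda>\<omega>. h (X \<omega>) * indicator (?A k) \<omega>)" for k
    unfolding eq using A[of k] by (intro integrable_mult_right integrable_real_indicator) (auto simp: emeasure_eq_measure)
  have val: "(\<integral>\<omega>. h (X \<omega>) * indicator (?A k) \<omega> \<partial>M) = h k * prob (?A k)" for k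
    unfolding eq using A[of k] by simp
  have "(\<integral>\<omega>. \<bar>h (X \<omega>) * indicator (?A k) \<omega>\<bar> \<partial>M) = \<bar>h k\<bar> * prob (?A k)" for k
    unfolding eq abs_mult using A[of k] by simp
  then have s': "summable (\<lambda>k. \<integral>\<omega>. \<bar>h (X \<omega>) * indicator (?A k) \<omega>\<bar> \<partial>M)"
    using s by simp
  show "integrable M (\<lambda>\<omega>. h (X \<omega>))"
    by (rule sums_partition(1)[OF int s'])
  show "(\<lambda>k. h k * prob (?A k)) sums expectation (\<lambda>\<omega>. h (X \<omega>))"
    using sums_partition(2)[OF int s'] unfolding val .
qed

lemma pgf_expectation:
  fixes X :: "'a \<Rightarrow> nat" and z :: real
  assumes X: "X \<in> M \<rightarrow>\<^sub>M count_space UNIV" and z: "\<bar>z\<bar> \<le> 1"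
  shows "integrable M (\<lambda>\<omega>. z ^ X \<omega>)"
    and "(\<lambda>k. z ^ k * prob {\<omega> \<in> space M. X \<omega> = k}) sums expectation (\<lambda>\<omega>. z ^ X \<omega>)"
proof -
  have le: "\<bar>z ^ k\<bar> \<le> 1" for k
    using z by (simp add: power_abs power_le_one)
  have "summable (\<lambda>k. \<bar>z ^ k\<bar> * prob {\<omega> \<in> space M. X \<omega> = k})"
  proof (rule summable_comparison_test[OF _ sums_summable[OF prob_nat_sums[OF X]]], intro exI allI impI)
    fix k
    show "norm (\<bar>z ^ k\<bar> * prob {\<omega> \<in> space M. X \<omega> = k}) \<le> prob {\<omega> \<in> space M. X \<omega> = k}"
      using mult_right_mono[OF le[of k], of "prob {\<omega> \<in> space M. X \<omega> = k}"] by simp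
  qed
  from expectation_nat_sums[OF X this] 
  show "integrable M (\<lambda>\<omega>. z ^ X \<omega>)"
    "(\<lambda>k. z ^ k * prob {\<omega> \<in> space M. X \<omega> = k}) sums expectation (\<lambda>\<omega>. z ^ X \<omega>)"
    by auto
qed

lemma bernoulli_pgf:
  fixes X :: "'a \<Rightarrow> nat" and z :: real
  assumes X: "X \<in> M \<rightarrow>\<^sub>M count_space UNIV" and z: "\<bar>z\<bar> \<le> 1"
    and a: "prob {\<omega> \<in> space M. X \<omega> = 1} = a" "prob {\<omega> \<in> space M. X \<omega> = 0} = 1 - a"
  shows "expectation (\<lambda>\<omega>. z ^ X \<omega>) = 1 - a + a * z"
proof -
  let ?p = "\<lambda>k. prob {\<omega> \<in> space M. X \<omega> = k}"
  \<comment> \<open>Only the masses at 0 and 1 are given; as they add up to 1, every other value has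
    probability 0.\<close>
  have zero: "z ^ k * ?p k = 0" if "k \<notin> {0, 1}" for k
  proof -
    have "sum ?p {0, 1, k} \<le> 1"
      using sum_le_suminf[OF sums_summable[OF prob_nat_sums[OF X]], of "{0, 1, k}"]
        sums_unique[OF prob_nat_sums[OF X]] by simp
    then have "?p k \<le> 0" using that a by simp
    then show ?thesis using measure_nonneg[of M "{\<omega> \<in> space M. X \<omega> = k}"] by simp
  qed
  have "(\<lambda>k. z ^ k * ?p k) sums (\<Sum>k\<in>{0, 1}. z ^ k * ?p k)"
    by (intro sums_finite zero) auto
  with pgf_expectation(2)[OF X z] have "expectation (\<lambda>\<omega>. z ^ X \<omega>) = (\<Sum>k\<in>{0, 1}. z ^ k * ?p k)"
    by (rule sums_unique2)
  then show ?thesis using a by simp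
qed

text \<open>On the event \<open>X = m\<close> the thinning is a sum of exactly \<open>m\<close>
  Bernoulli variables, each contributing the factor \<open>1 - a + a * z\<close> by
  independence.\<close>

lemma thinning_pgf:
  fixes X Y :: "'a \<Rightarrow> nat" and z :: real
  assumes thin: "is_thinning M a X Y" and z: "\<bar>z\<bar> \<le> 1" and a: "0 \<le> a" "a \<le> 1"
  shows "(\<lambda>k. prob {\<omega> \<in> space M. X \<omega> = k} * (1 - a + a * z) ^ k) sums expectation (\<lambda>\<omega>. z ^ Y \<omega>)"
proof -
  obtain B where B: "indep_vars (\<lambda>_. count_space UNIV) (\<lambda>i. if i = 0 then X else B i) UNIV"
    "\<And>i. i \<ge> 1 \<Longrightarrow> prob {\<omega> \<in> space M. B i \<omega> = 1} = a \<and> prob {\<omega> \<in> space M. B i \<omega> = 0} = 1 - a"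
    "\<And>\<omega>. \<omega> \<in> space M \<Longrightarrow> Y \<omega> = (\<Sum>i=1..X \<omega>. B i \<omega>)"
    using thin unfolding is_thinning_def by auto
  define V where "V i = (if i = 0 then X else B i)" for i
  have V: "V i \<in> M \<rightarrow>\<^sub>M count_space UNIV" for i
    using B(1) unfolding indep_vars_def V_def by auto
  have X: "X \<in> M \<rightarrow>\<^sub>M count_space UNIV"
    using V[of 0] by (simp add: V_def)
  let ?A = "\<lambda>m. {\<omega> \<in> space M. X \<omega> = m}"
  \<comment> \<open>Index 0 carries the indicator of \<open>X = m\<close>, so conditioning and
    powers form one product of functions of independent variables.\<close>
  define G where "G m i v = (if i = 0 then indicator {m} v else z ^ v)" for m i v :: nat
  have G_le: "\<bar>G m i v\<bar> \<le> 1" for m i v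
    using z by (auto simp: G_def indicator_def power_abs power_le_one)
  have GV: "random_variable borel (\<lambda>\<omega>. G m i (V i \<omega>))" for m i
    using V[of i] by (rule measurable_compose) simp
  have int_G: "integrable M (\<lambda>\<omega>. G m i (V i \<omega>))" for m i
    using G_le GV by (intro integrable_const_bound[where B=1]) auto
  have ind: "indep_vars (\<lambda>_. borel) (\<lambda>i \<omega>. G m i (V i \<omega>)) {0..m}" for m
    using indep_vars_subset[OF B(1), of "{0..m}"] unfolding V_def[symmetric]
    by (rule indep_vars_compose2) auto
  have prod: "z ^ Y \<omega> * indicator (?A m) \<omega> = (\<Prod>i\<in>{0..m}. G m i (V i \<omega>))" if "\<omega> \<in> space M" for \<omega> m
  proof -
    have "(\<Prod>i\<in>{0..m}. G m i (V i \<omega>)) = indicator {m} (X \<omega>) * (\<Prod>i=1..m. z ^ B i \<omega>)"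
      by (subst prod.atLeast_Suc_atMost) (auto simp: G_def V_def intro!: prod.cong)
    also have "\<dots> = z ^ Y \<omega> * indicator (?A m) \<omega>"
      using B(3)[OF that] that by (auto simp: indicator_def power_sum)
    finally show ?thesis ..
  qed
  have int: "integrable M (\<lambda>\<omega>. z ^ Y \<omega> * indicator (?A m) \<omega>)" for m
    using indep_vars_integrable[OF _ ind int_G, of m]
    by (subst Bochner_Integration.integrable_cong[OF refl prod]) auto
  have EB: "expectation (\<lambda>\<omega>. G m i (V i \<omega>)) = 1 - a + a * z" if "i \<in> {Suc 0..m}" for i m
    using bernoulli_pgf[of "B i" z a] V[of i] B(2)[of i] z that by (simp add: G_def V_def)
  have "expectation (\<lambda>\<omega>. G m 0 (V 0 \<omega>)) = expectation (indicator (?A m))" for m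
    by (intro Bochner_Integration.integral_cong) (auto simp: G_def V_def indicator_def)
  then have E0: "expectation (\<lambda>\<omega>. G m 0 (V 0 \<omega>)) = prob (?A m)" for m
    using X by simp
  have val: "(\<integral>\<omega>. z ^ Y \<omega> * indicator (?A m) \<omega> \<partial>M) = prob (?A m) * (1 - a + a * z) ^ m" for m
  proof -
    have "(\<integral>\<omega>. z ^ Y \<omega> * indicator (?A m) \<omega> \<partial>M) = expectation (\<lambda>\<omega>. \<Prod>i\<in>{0..m}. G m i (V i \<omega>))"
      by (intro Bochner_Integration.integral_cong refl prod)
    also have "\<dots> = (\<Prod>i\<in>{0..m}. expectation (\<lambda>\<omega>. G m i (V i \<omega>)))"
      by (intro indep_vars_lebesgue_integral ind int_G) auto
    also have "\<dots> = prob (?A m) * (\<Prod>i\<in>{Suc 0..m}. 1 - a + a * z)"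
      by (subst prod.atLeast_Suc_atMost) (auto simp: E0 EB)
    finally show ?thesis by simp
  qed
  have abs_le: "(\<integral>\<omega>. \<bar>z ^ Y \<omega> * indicator (?A m) \<omega>\<bar> \<partial>M) \<le> prob (?A m)" for m
  proof -
    have "(\<integral>\<omega>. \<bar>z ^ Y \<omega> * indicator (?A m) \<omega>\<bar> \<partial>M) \<le> expectation (indicator (?A m))"
      using X z by (intro integral_mono integrable_abs int integrable_real_indicator)
        (auto simp: abs_mult power_abs power_le_one emeasure_eq_measure indicator_def)
    also have "\<dots> = prob (?A m)" using X by simp
    finally show ?thesis .
  qed
  have "summable (\<lambda>m. \<integral>\<omega>. \<bar>z ^ Y \<omega> * indicator (?A m) \<omega>\<bar> \<partial>M)"
    by (rule summable_comparison_test[OF _ sums_summable[OF prob_nat_sums[OF X]]])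
      (use abs_le in auto)
  from sums_partition(2)[OF int this] show ?thesis
    unfolding val .
qed

end

section \<open>Entropy asymptotics of the thinned sums\<close>

theorem proposition3p20:
  fixes M :: "'a measure"
    and X :: "'a \<Rightarrow> nat"
    and Xs :: "nat \<Rightarrow> 'a \<Rightarrow> nat"
    and Y :: "nat \<Rightarrow> nat \<Rightarrow> 'a \<Rightarrow> nat"
    and f :: "nat \<Rightarrow> real"
    and T :: real
  assumes M: "prob_space M"
    and X: "X \<in> M \<rightarrow>\<^sub>M count_space UNIV"
    and T: "T = prob_space.expectation M (\<lambda>\<omega>. real (X \<omega>))" "T > 0"
    and density: "has_poisson_density M X T f"
    and indep: "prob_space.indep_vars M (\<lambda>_. count_space UNIV) Xs {1..}"
    and copies: "\<And>i. i \<ge> 1 \<Longrightarrow> distr M (count_space UNIV) (Xs i) = distr M (count_space UNIV) X"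
    and thin: "\<And>n i. n \<ge> 1 \<Longrightarrow> i \<in> {1..n} \<Longrightarrow> is_thinning M (1 / real n) (Xs i) (Y n i)"
    and indep_thin: "\<And>n. n \<ge> 1 \<Longrightarrow> prob_space.indep_vars M (\<lambda>_. count_space UNIV) (Y n) {1..n}"
    and bounded: "bounded_away f"
  shows "limsup (\<lambda>n. ereal ((real n)\<^sup>2) * poisson_rel_entropy M (\<lambda>\<omega>. \<Sum>i=1..n. Y n i \<omega>) T)
           \<le> ereal ((prob_space.variance M (\<lambda>\<omega>. real (X \<omega>)) / T - 1)\<^sup>2)"
proof -
  interpret prob_space M by (rule M)
  let ?\<pi> = "pmf (poisson_pmf T)"
  define p where "p k = prob {\<omega> \<in> space M. X \<omega> = k}" for k
  have p_eq: "p k = f k * ?\<pi> k" for k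
    using density by (simp add: has_poisson_density_def p_def)
  obtain c0 where c0: "f k \<le> c0" for k
    using bounded unfolding bounded_away_def by auto
  \<comment> \<open>The ceiling makes the bound a natural number, and the successor guarantees that
    it is at least 1.\<close>
  define C where "C = Suc (nat \<lceil>c0\<rceil>)"
  have C: "f k \<le> real C" for k
    using c0[of k] unfolding C_def by linarith
  have p_le: "p k \<le> real C * ?\<pi> k" for k
    unfolding p_eq by (intro mult_right_mono C) auto
  have p_nonneg: "0 \<le> p k" for k
    by (simp add: p_def)
  have binom: "integrable M (\<lambda>\<omega>. real (X \<omega> choose i))"
    "(\<lambda>k. real (k choose i) * p k) sums expectation (\<lambda>\<omega>. real (X \<omega> choose i))" for i
  proof -
    have s: "summable (\<lambda>k. ?\<pi> k * (fact i * real (k choose i)) * 1 ^ k * (real C / fact i))"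
      by (intro summable_mult2 sums_summable[OF poisson_binomial_sums] T)
    have "summable (\<lambda>k. \<bar>real (k choose i)\<bar> * p k)"
    proof (rule summable_comparison_test[OF _ s], intro exI allI impI)
      fix k
      show "norm (\<bar>real (k choose i)\<bar> * p k) \<le> ?\<pi> k * (fact i * real (k choose i)) * 1 ^ k * (real C / fact i)"
        using mult_left_mono[OF p_le[of k], of "real (k choose i)"] p_nonneg[of k]
        by (simp add: abs_mult mult_ac)
    qed
    from expectation_nat_sums[OF X this[unfolded p_def]]
    show "integrable M (\<lambda>\<omega>. real (X \<omega> choose i))"
      "(\<lambda>k. real (k choose i) * p k) sums expectation (\<lambda>\<omega>. real (X \<omega> choose i))"
      by (auto simp: p_def)
  qed
  interpret poisson_dominated p T C
  proof
    show "p sums 1"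
      using prob_nat_sums[OF X] by (simp add: p_def[abs_def])
    show "(\<lambda>k. p k * real k) sums T"
      using binom(2)[of 1] T(1) by (simp add: mult.commute)
  qed (use T p_nonneg p_le in \<open>auto simp: C_def simp del: pmf_poisson\<close>)

  \<comment> \<open>Squares are written in binomial coefficients because \<open>B $ 2\<close> is
    given by \<open>fmom 2\<close>.\<close>
  have sq: "(real k)\<^sup>2 = 2 * real (k choose 2) + real (k choose 1)" for k
    by (simp add: binomial_gbinomial gbinomial_prod_rev numeral_2_eq_2 field_simps)
  have "variance (\<lambda>\<omega>. real (X \<omega>)) = expectation (\<lambda>\<omega>. (real (X \<omega>))\<^sup>2) - T\<^sup>2"
    using binom(1)[of 1] binom(1)[of 2] unfolding T(1)
    by (intro variance_eq) (auto simp: sq)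
  also have "expectation (\<lambda>\<omega>. (real (X \<omega>))\<^sup>2) = 2 * expectation (\<lambda>\<omega>. real (X \<omega> choose 2)) + T"
    unfolding sq using binom(1)[of 1] binom(1)[of 2] T(1) by simp
  also have "expectation (\<lambda>\<omega>. real (X \<omega> choose 2)) = fmom 2"
    using sums_unique[OF binom(2)[of 2]] by (simp add: fmom_def mult.commute)
  finally have var: "variance (\<lambda>\<omega>. real (X \<omega>)) = 2 * fps_nth B 2 + T"
    by (simp add: B_012)

  define V where "V n = \<bar>fps_nth B 2\<bar> * sqrt 2 / (T * real n) + ratio n ^ 3 / (1 - ratio n)" for n
  define S where "S n = (\<lambda>\<omega>. \<Sum>i=1..n. Y n i \<omega>)" for n
  have entropy: "poisson_rel_entropy M (S n) T \<le> ereal ((V n)\<^sup>2)" if n: "n \<ge> 1" and ratio: "ratio n < 1" for n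
  proof -
    have Y: "Y n i \<in> M \<rightarrow>\<^sub>M count_space UNIV" if "i \<in> {1..n}" for i
      using indep_thin[OF n] that unfolding indep_vars_def by auto
    have S: "S n \<in> M \<rightarrow>\<^sub>M count_space UNIV"
      unfolding S_def by (intro measurable_sum_nat Y)
    define q where "q k = prob {\<omega> \<in> space M. S n \<omega> = k}" for k
    \<comment> \<open>Independence multiplies the generating functions of the thinnings; each has
      argument 1 - 1/n + z/n = 1 + (z - 1)/n.\<close>
    have q_pgf: "(\<lambda>k. q k * z ^ k) sums (pgf (1 + (z - 1) / real n) ^ n)" if z: "\<bar>z\<bar> < 1" for z
    proof -
      have z1: "\<bar>z\<bar> \<le> 1" using z by simp
      have EY: "expectation (\<lambda>\<omega>. z ^ Y n i \<omega>) = pgf (1 + (z - 1) / real n)" if i: "i \<in> {1..n}" for i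
      proof -
        have Xi: "Xs i \<in> M \<rightarrow>\<^sub>M count_space UNIV"
          using indep i unfolding indep_vars_def by auto
        have "prob {\<omega> \<in> space M. Xs i \<omega> = k} = p k" for k
        proof -
          have "measure (distr M (count_space UNIV) (Xs i)) {k} = measure (distr M (count_space UNIV) X) {k}"
            using copies[of i] i by simp
          then show ?thesis
            using Xi X by (simp add: measure_distr vimage_def Int_def p_def conj_commute)
        qed
        then have "(\<lambda>k. p k * (1 - 1 / real n + 1 / real n * z) ^ k) sums expectation (\<lambda>\<omega>. z ^ Y n i \<omega>)"
          using thinning_pgf[OF thin[OF n i] z1] n by simp
        from sums_unique[OF this] show ?thesis
          by (simp add: pgf_def diff_divide_distrib add_diff_eq diff_add_eq)
      qed
      have "expectation (\<lambda>\<omega>. z ^ S n \<omega>) = expectation (\<lambda>\<omega>. \<Prod>i\<in>{1..n}. z ^ Y n i \<omega>)"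
        by (simp add: S_def power_sum)
      also have "\<dots> = (\<Prod>i\<in>{1..n}. expectation (\<lambda>\<omega>. z ^ Y n i \<omega>))"
      proof (rule indep_vars_lebesgue_integral)
        show "indep_vars (\<lambda>_. borel) (\<lambda>i \<omega>. z ^ Y n i \<omega>) {1..n}"
          by (rule indep_vars_compose2[OF indep_thin[OF n]]) auto
      qed (use Y z1 in \<open>auto intro: pgf_expectation\<close>)
      also have "\<dots> = pgf (1 + (z - 1) / real n) ^ n"
        using EY by simp
      finally show ?thesis
        using pgf_expectation(2)[OF S z1] by (simp add: q_def mult.commute)
    qed
    note chi = chi_square_le[OF n ratio q_pgf, folded V_def]
    have \<pi>: "?\<pi> k > 0" for k
      using T(2) by simp
    have \<pi>_sums: "?\<pi> sums 1"
      using poisson_pgf_sums[OF T(2), of 1] by simp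
    have q_sums: "q sums 1"
      using prob_nat_sums[OF S] by (simp add: q_def[abs_def])
    have q_nonneg: "0 \<le> q k" for k
      by (simp add: q_def)
    note ent = entropy_le_chi_square[OF \<pi> \<pi>_sums q_nonneg q_sums chi]
    have "poisson_density M (S n) T = (\<lambda>k. q k / ?\<pi> k)"
      by (simp add: poisson_density_def fun_eq_iff q_def del: pmf_poisson)
    then show ?thesis
      using ent unfolding poisson_rel_entropy_def by (simp only: Let_def if_True ereal_less_eq)
  qed

  \<comment> \<open>The geometric tail bound needs \<open>ratio n < 1\<close>; large
    \<open>n\<close> suffice for the limsup.\<close>
  have "eventually (\<lambda>n. ratio n < 1) sequentially"
    using ratio_tendsto by (rule order_tendstoD) simp
  then have ev: "eventually (\<lambda>n. ereal ((real n)\<^sup>2) * poisson_rel_entropy M (S n) T \<le> ereal ((real n * V n)\<^sup>2)) sequentially"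
    using eventually_ge_at_top[of 1]
  proof eventually_elim
    case (elim n)
    have "ereal ((real n)\<^sup>2) * poisson_rel_entropy M (S n) T \<le> ereal ((real n)\<^sup>2) * ereal ((V n)\<^sup>2)"
      using elim by (intro ereal_mult_left_mono entropy) auto
    then show ?case by (simp add: power_mult_distrib)
  qed
  have "limsup (\<lambda>n. ereal ((real n)\<^sup>2) * poisson_rel_entropy M (S n) T) \<le> limsup (\<lambda>n. ereal ((real n * V n)\<^sup>2))"
    by (rule Limsup_mono[OF ev])
  also have "\<dots> = ereal (2 * (fps_nth B 2)\<^sup>2 / T\<^sup>2)"
    using scaled_bound_tendsto unfolding V_def[symmetric]
    by (intro lim_imp_Limsup) auto
  \<comment> \<open>Since Var X / T - 1 equals twice \<open>B $ 2\<close> over \<open>T\<close>, the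
    limit is half of the right-hand side.\<close>
  also have "\<dots> \<le> ereal ((variance (\<lambda>\<omega>. real (X \<omega>)) / T - 1)\<^sup>2)"
  proof -
    have "variance (\<lambda>\<omega>. real (X \<omega>)) / T - 1 = 2 * fps_nth B 2 / T"
      unfolding var using T(2) by (simp add: field_simps)
    then show ?thesis
      by (simp add: power_mult_distrib power_divide divide_right_mono)
  qed
  finally show ?thesis
    unfolding S_def .
qed

end
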